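(* Let $\Omega=[0,1]^d$, $K(\xi)=\xi^{2\mathrm{k}}=\prod_{j}\xi_j^{2k_j}$ with $\mathrm{k}\in\mathbb{N}^d$ having at least one positive entry, and let $\varphi(\xi)\propto b(\xi)\,\xi^{\mathrm{h}}$ be a probability density on $\Omega$, where $\mathrm{h}\in\mathbb{N}^d$ and $b$ is a real analytic function on an open subset of $\mathbb{R}^d$ containing $\Omega$ with $b>0$ on $\Omega$. For a probability measure $\rho\ll\varphi$ on $\Omega$ put $$\Psi_n(\rho)=-\Big[\int_\Omega nK(\xi)\,\rho(d\xi)+D(\rho\,\|\,\varphi)\Big],$$ let $\mathcal{F}_{\mathrm{MF}}=\{\rho=\rho_1\otimes\cdots\otimes\rho_d:\ \rho\ll\varphi \text{ a probability measure on }\Omega\}$, and let $\mathrm{ELBO}(\mathcal{F}_{\mathrm{MF}})=\sup_{\rho\in\mathcal{F}_{\mathrm{MF}}}\Psi_n(\rho)$. Then there exists a constant $C$ independent of $n$ such that, for all $n\ge 1$, $$\mathrm{ELBO}(\mathcal{F}_{\mathrm{MF}})\ge-\lambda\log n-C,\qquad \lambda=\min_j\frac{h_j+1}{2k_j}.$$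
   Context: $\mathbb{N}$ includes $0$; $(h_j+1)/(2k_j)$ is interpreted as $+\infty$ when $k_j=0$. $D(\mu\,\|\,\nu)=\mathbb{E}_\mu\log(d\mu/d\nu)$ is the Kullback--Leibler divergence, and $\rho\ll\varphi$ means absolute continuity with respect to the measure with density $\varphi$. By the Gibbs variational inequality $\Psi_n(\rho)\le\log\mathcal{Z}_K(n)$ with $\mathcal{Z}_K(n)=\int_\Omega e^{-nK(\xi)}\varphi(\xi)\,d\xi$. *)

theory Defs
  imports "HOL-Probability.Probability"
begin

definition mpow :: "real^'d \<Rightarrow> nat^'d \<Rightarrow> real" where
  "mpow x a = (\<Prod>j\<in>UNIV. (x $ j) ^ (a $ j))"

text \<open>Each point of the open set \<open>U\<close> has a ball on which \<open>f\<close> is the sum of a multivariate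
  power series. Convergence over the multi-indices is unconditional, hence absolute.\<close>

definition real_analytic_on :: "(real^'d \<Rightarrow> real) \<Rightarrow> (real^'d) set \<Rightarrow> bool" where
  "real_analytic_on f U \<longleftrightarrow> open U \<and>
     (\<forall>a\<in>U. \<exists>r>0. \<exists>c :: nat^'d \<Rightarrow> real.
        \<forall>x\<in>ball a r. ((\<lambda>m. c m * mpow (x - a) m) has_sum f x) UNIV)"

definition unit_cube :: "(real^'d) set" where
  "unit_cube = {x. \<forall>j. 0 \<le> x $ j \<and> x $ j \<le> 1}"

definition normal_crossing :: "nat^'d \<Rightarrow> real^'d \<Rightarrow> real" where
  "normal_crossing k x = (\<Prod>j\<in>UNIV. (x $ j) ^ (2 * k $ j))"

definition cube_measure :: "(real^'d \<Rightarrow> real) \<Rightarrow> (real^'d) measure" where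
  "cube_measure \<phi> = density lborel (\<lambda>x. ennreal (\<phi> x) * indicator unit_cube x)"

text \<open>A probability measure on a subset \<open>A\<close> of Euclidean space is represented by a Borel
  probability measure on the whole space that gives \<open>A\<close> full mass.\<close>

definition prob_measure_on :: "'a::topological_space set \<Rightarrow> 'a measure \<Rightarrow> bool" where
  "prob_measure_on A \<rho> \<longleftrightarrow> sets \<rho> = sets borel \<and> prob_space \<rho> \<and> emeasure \<rho> A = 1"

text \<open>\<open>kl_div \<rho> \<nu>\<close> is \<open>D(\<rho> \<parallel> \<nu>)\<close> for probability measures, with natural logarithm; the library
  function \<open>KL_divergence\<close> takes its measures in the opposite order. The Bochner integral in
  \<open>KL_divergence\<close> is \<open>0\<close> when \<open>log (d\<rho>/d\<nu>)\<close> is not \<open>\<rho>\<close>-integrable. The negative part of this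
  logarithm always has a finite integral, so \<open>D(\<rho> \<parallel> \<nu>) = \<infinity>\<close> in exactly that case.\<close>

definition kl_div :: "'a measure \<Rightarrow> 'a measure \<Rightarrow> ereal" where
  "kl_div \<rho> \<nu> =
     (if absolutely_continuous \<nu> \<rho> \<and> integrable \<rho> (entropy_density (exp 1) \<nu> \<rho>)
      then ereal (KL_divergence (exp 1) \<nu> \<rho>) else \<infinity>)"

definition Psi :: "(real^'d \<Rightarrow> real) \<Rightarrow> (real^'d \<Rightarrow> real) \<Rightarrow> nat \<Rightarrow> (real^'d) measure \<Rightarrow> ereal" where
  "Psi K \<phi> n \<rho> =
     - (ereal (LINT x:unit_cube|\<rho>. real n * K x) + kl_div \<rho> (cube_measure \<phi>))"

definition product_measure :: "('d \<Rightarrow> real measure) \<Rightarrow> (real^'d) measure" where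
  "product_measure \<rho>s = distr (Pi\<^sub>M UNIV \<rho>s) borel (\<lambda>x. \<chi> j. x j)"

definition mean_field :: "(real^'d \<Rightarrow> real) \<Rightarrow> (real^'d) measure set" where
  "mean_field \<phi> = {\<rho>. prob_measure_on unit_cube \<rho> \<and> absolutely_continuous (cube_measure \<phi>) \<rho> \<and>
     (\<exists>\<rho>s. (\<forall>j. prob_measure_on {0..1} (\<rho>s j)) \<and> \<rho> = product_measure \<rho>s)}"

definition ELBO :: "(real^'d \<Rightarrow> real) \<Rightarrow> (real^'d \<Rightarrow> real) \<Rightarrow> nat \<Rightarrow> (real^'d) measure set \<Rightarrow> ereal" where
  "ELBO K \<phi> n F = (SUP \<rho>\<in>F. Psi K \<phi> n \<rho>)"

definition rlct :: "nat^'d \<Rightarrow> nat^'d \<Rightarrow> ereal" where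
  "rlct k h = Min (range (\<lambda>j. if k $ j = 0 then \<infinity>
                              else ereal ((real (h $ j) + 1) / (2 * real (k $ j)))))"

end

(* Test the supremum on one explicit product measure. Let j attain the minimum defining lambda and put
   epsilon = n^(-1/(2 k_j)). Give coordinate j the density proportional to x^h_j on [0, epsilon] and
   every other coordinate i the density proportional to x^h_i on [0, 1]. On the support n K is at most
   n epsilon^(2 k_j) = 1, and the density with respect to phi is a constant multiple of
   epsilon^(-(h_j + 1)) / b. Since b is bounded away from 0 on the cube, the divergence is at most
   -(h_j + 1) ln epsilon + O(1) = lambda ln n + O(1). *)

theory Submission
  imports Defs
begin

section \<open>Continuity of real analytic functions\<close>

lemma continuous_on_mpow: "continuous_on A (\<lambda>x. mpow (x - a) m)"
  unfolding mpow_def by (intro continuous_intros)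

text \<open>Summability at the corner \<open>a + (s, \<dots>, s)\<close> dominates the series on the cube of radius \<open>s\<close>
  around \<open>a\<close>, so the Weierstrass M-test applies there.\<close>

lemma real_analytic_on_imp_continuous_on:
  fixes f :: "real^'d \<Rightarrow> real"
  assumes "real_analytic_on f U"
  shows "continuous_on U f"
proof -
  have "isCont f a" if "a \<in> U" for a
  proof -
    obtain r c where r: "r > 0"
      and sums: "\<And>x. x \<in> ball a r \<Longrightarrow> ((\<lambda>m. c m * mpow (x - a) m) has_sum f x) UNIV"
      using assms \<open>a \<in> U\<close> unfolding real_analytic_on_def by metis
    \<comment> \<open>The corner displacement \<open>(s, ..., s)\<close> has l1 norm
      \<open>CARD('d) * s = r / 2\<close>, so the corner stays inside the ball of
      convergence.\<close>
    define s where "s = r / (2 * real CARD('d))"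
    have s: "s > 0" using r by (simp add: s_def)
    have "norm (\<chi> j::'d. s) \<le> (\<Sum>j\<in>(UNIV::'d set). \<bar>s\<bar>)"
      using norm_le_l1_cart[of "\<chi> j::'d. s"] by simp
    also have "\<dots> < r" using s r by (simp add: s_def)
    finally have corner: "a + (\<chi> j. s) \<in> ball a r" by (simp add: dist_norm)
    have "(\<lambda>m. c m * mpow (\<chi> j. s) m) summable_on UNIV"
      using sums[OF corner] by (auto simp: summable_on_def)
    then have summable: "(\<lambda>m. norm (c m * mpow (\<chi> j. s) m)) summable_on UNIV"
      by (rule summable_on_iff_abs_summable_on_real[THEN iffD1])
    \<comment> \<open>Radius \<open>r\<close> keeps the series convergent to \<open>f\<close>;
      radius \<open>s\<close> keeps every coordinate of \<open>x - a\<close> below the corner's,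
      which is what domination needs.\<close>
    define B where "B = ball a (min r s)"
    have bound: "norm (c m * mpow (x - a) m) \<le> norm (c m * mpow (\<chi> j. s) m)" if "x \<in> B" for x m
    proof -
      have "\<bar>(x - a) $ j\<bar> \<le> s" for j
        using component_le_norm_cart[of "x - a" j] that
        by (simp add: B_def dist_norm norm_minus_commute)
      then have "\<bar>mpow (x - a) m\<bar> \<le> \<bar>mpow (\<chi> j. s) m\<bar>"
        using s unfolding mpow_def abs_prod power_abs by (intro prod_mono conjI power_mono) auto
      then show ?thesis by (simp add: abs_mult mult_left_mono)
    qed
    have "uniform_limit B (\<lambda>X y. \<Sum>m\<in>X. c m * mpow (y - a) m) f (finite_subsets_at_top UNIV)"
      using bound sums summable
      by (intro Weierstrass_m_test_general'[where M = "\<lambda>m. norm (c m * mpow (\<chi> j. s) m)"])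
         (auto simp: B_def)
    then have "continuous_on B f"
      by (rule uniform_limit_theorem[rotated])
         (auto intro!: always_eventually continuous_on_sum continuous_on_mult continuous_on_mpow)
    then show ?thesis
      using r s by (simp add: B_def continuous_on_eq_continuous_at)
  qed
  then show ?thesis by (simp add: continuous_at_imp_continuous_on)
qed

section \<open>Product measures on \<open>real^'d\<close> and their densities\<close>

lemma measurable_vec_lambda:
  "(\<lambda>x. \<chi> j::'d::finite. x j) \<in> measurable (Pi\<^sub>M UNIV (\<lambda>_. borel :: real measure)) (borel :: (real^'d) measure)"
proof (rule borel_measurable_euclidean_space[THEN iffD2], rule ballI)
  fix i :: "real^'d" assume "i \<in> Basis"
  then obtain j where "i = axis j 1" by (auto simp: Basis_vec_def)
  then show "(\<lambda>x. (\<chi> j. x j) \<bullet> i) \<in> borel_measurable (Pi\<^sub>M UNIV (\<lambda>_. borel :: real measure))"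
    by (simp add: inner_axis)
qed

lemma sets_product_measure [simp]: "sets (product_measure \<rho>s) = sets borel"
  by (simp add: product_measure_def)

text \<open>Lebesgue measure is determined by its values on boxes, and the coordinate map pulls a
  box back to a product of intervals.\<close>

lemma product_measure_lborel: "product_measure (\<lambda>_::'d::finite. lborel) = (lborel :: (real^'d) measure)"
proof (rule lborel_eqI[symmetric])
  interpret product_sigma_finite "\<lambda>_::'d. lborel :: real measure" by standard
  have [measurable]: "(\<lambda>x. \<chi> j::'d. x j) \<in> measurable (Pi\<^sub>M UNIV (\<lambda>_. lborel :: real measure)) borel"
    using measurable_vec_lambda by (simp cong: measurable_cong_sets sets_PiM_cong)
  fix l u :: "real^'d" assume le: "\<And>i. i \<in> Basis \<Longrightarrow> l \<bullet> i \<le> u \<bullet> i"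
  have le': "l $ j \<le> u $ j" for j
    using le[of "axis j 1"] by (simp add: axis_in_Basis_iff inner_axis)
  have "emeasure (product_measure (\<lambda>_. lborel)) (box l u) =
      emeasure (Pi\<^sub>M UNIV (\<lambda>_. lborel)) (Pi\<^sub>E UNIV (\<lambda>j. box (l $ j) (u $ j)))"
    unfolding product_measure_def
    by (subst emeasure_distr) (auto simp: mem_box_cart space_PiM PiE_def Pi_iff intro!: arg_cong2[where f = emeasure])
  also have "\<dots> = (\<Prod>j\<in>UNIV. ennreal (u $ j - l $ j))"
    using le' by (subst emeasure_PiM) (auto simp: emeasure_lborel_box_eq)
  also have "\<dots> = ennreal (\<Prod>j\<in>UNIV. (u - l) $ j)"
    using le' by (subst prod_ennreal) auto
  \<comment> \<open>The basis vectors are exactly the \<open>axis j 1\<close>, one for each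
    coordinate.\<close>
  also have "(\<Prod>j\<in>UNIV. (u - l) $ j) = (\<Prod>i\<in>Basis. (u - l) \<bullet> i)"
  proof -
    have *: "Basis = (\<lambda>j. axis j (1::real)) ` (UNIV :: 'd set)" by (auto simp: Basis_vec_def)
    show ?thesis unfolding *
      by (subst prod.reindex) (auto simp: inj_on_def axis_eq_axis inner_axis)
  qed
  finally show "emeasure (product_measure (\<lambda>_. lborel)) (box l u) = (\<Prod>i\<in>Basis. (u - l) \<bullet> i)" .
qed simp

text \<open>On measurable rectangles Tonelli's theorem factors the integral of the product.
  Sigma-finiteness of the factors makes rectangles determine the product measure, and the coordinate
  map then transports the identity to vectors.\<close>

lemma product_measure_density:
  fixes f :: "'d::finite \<Rightarrow> real \<Rightarrow> ennreal"
  assumes [measurable]: "\<And>j. f j \<in> borel_measurable borel"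
    and sf: "\<And>j. sigma_finite_measure (density lborel (f j))"
  shows "product_measure (\<lambda>j. density lborel (f j)) = density lborel (\<lambda>x. \<Prod>j\<in>UNIV. f j (x $ j))"
proof -
  interpret L: product_sigma_finite "\<lambda>_::'d. lborel :: real measure" by standard
  interpret D: product_sigma_finite "\<lambda>j. density lborel (f j)"
    using sf by (simp add: product_sigma_finite_def)
  have [measurable]: "(\<lambda>x. \<chi> j::'d. x j) \<in> measurable (Pi\<^sub>M UNIV (\<lambda>_. lborel :: real measure)) borel"
    using measurable_vec_lambda by (simp cong: measurable_cong_sets sets_PiM_cong)
  have "density (Pi\<^sub>M UNIV (\<lambda>_. lborel)) (\<lambda>x. \<Prod>j\<in>UNIV. f j (x j)) = Pi\<^sub>M UNIV (\<lambda>j. density lborel (f j))"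
  proof (rule D.PiM_eqI)
    show "sets (density (Pi\<^sub>M UNIV (\<lambda>_. lborel)) (\<lambda>x. \<Prod>j\<in>UNIV. f j (x j))) =
        sets (Pi\<^sub>M UNIV (\<lambda>j. density lborel (f j)))"
      by (simp cong: sets_PiM_cong)
    fix A :: "'d \<Rightarrow> real set" assume A: "\<And>j. j \<in> UNIV \<Longrightarrow> A j \<in> sets (density lborel (f j))"
    then have [measurable]: "\<And>j. A j \<in> sets borel" by simp
    have [measurable]: "Pi\<^sub>E UNIV A \<in> sets (Pi\<^sub>M UNIV (\<lambda>_. lborel))"
      by (intro sets_PiM_I_finite) auto
    have "emeasure (density (Pi\<^sub>M UNIV (\<lambda>_. lborel)) (\<lambda>x. \<Prod>j\<in>UNIV. f j (x j))) (Pi\<^sub>E UNIV A)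
        = (\<integral>\<^sup>+x. (\<Prod>j\<in>UNIV. f j (x j)) * indicator (Pi\<^sub>E UNIV A) x \<partial>Pi\<^sub>M UNIV (\<lambda>_. lborel))"
      by (subst emeasure_density) auto
    also have "\<dots> = (\<integral>\<^sup>+x. (\<Prod>j\<in>UNIV. f j (x j) * indicator (A j) (x j)) \<partial>Pi\<^sub>M UNIV (\<lambda>_. lborel))"
      by (intro nn_integral_cong) (auto simp: prod.distrib indicator_def PiE_def Pi_def prod_zero_iff)
    also have "\<dots> = (\<Prod>j\<in>UNIV. \<integral>\<^sup>+x. f j x * indicator (A j) x \<partial>lborel)"
      by (subst L.product_nn_integral_prod) auto
    also have "\<dots> = (\<Prod>j\<in>UNIV. emeasure (density lborel (f j)) (A j))"
      by (intro prod.cong) (auto simp: emeasure_density)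
    finally show "emeasure (density (Pi\<^sub>M UNIV (\<lambda>_. lborel)) (\<lambda>x. \<Prod>j\<in>UNIV. f j (x j))) (Pi\<^sub>E UNIV A)
        = (\<Prod>j\<in>UNIV. emeasure (density lborel (f j)) (A j))" .
  qed simp
  \<comment> \<open>Writing \<open>x j\<close> as \<open>(\<chi> j. x j) $ j\<close> shows the
    density as a function of the image point, the form in which it passes through
    \<open>distr\<close>.\<close>
  then have "product_measure (\<lambda>j. density lborel (f j)) =
      distr (density (Pi\<^sub>M UNIV (\<lambda>_. lborel)) (\<lambda>x. \<Prod>j\<in>UNIV. f j ((\<chi> j. x j) $ j))) borel (\<lambda>x. \<chi> j. x j)"
    by (simp add: product_measure_def)
  also have "\<dots> = density (product_measure (\<lambda>_. lborel)) (\<lambda>x. \<Prod>j\<in>UNIV. f j (x $ j))"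
    unfolding product_measure_def by (subst density_distr) auto
  finally show ?thesis by (simp add: product_measure_lborel)
qed

section \<open>A power integral and a divergence bound\<close>

lemma nn_integral_power_density:
  fixes e :: real
  assumes "e > 0"
  shows "(\<integral>\<^sup>+x. ennreal (real (Suc a) / e ^ Suc a * x ^ a) * indicator {0..e} x \<partial>lborel) = 1"
proof -
  have "(\<integral>\<^sup>+x. ennreal (real (Suc a) / e ^ Suc a * x ^ a) * indicator {0..e} x \<partial>lborel)
      = ennreal ((e / e) ^ Suc a - (0 / e) ^ Suc a)"
  \<comment> \<open>The antiderivative is \<open>(x / e) ^ Suc a\<close>, which runs from 0 to 1
    over the interval.\<close>
  proof (rule nn_integral_FTC_Icc)
    fix x :: real
    show "((\<lambda>x. (x / e) ^ Suc a) has_real_derivative real (Suc a) / e ^ Suc a * x ^ a) (at x)"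
      using DERIV_power_Suc[OF DERIV_cdivide[OF DERIV_ident], of e a x UNIV] assms
      by (simp add: field_simps)
  qed (use assms in auto)
  then show ?thesis using assms by (simp del: power_Suc of_nat_Suc times_divide_eq_left)
qed

text \<open>By uniqueness the Radon-Nikodym derivative is \<open>g\<close> almost everywhere. The
  two-sided bound makes its logarithm integrable, which rules out the infinite branch of
  \<open>kl_div\<close>; the mean of a function below \<open>B\<close> is then at most
  \<open>B\<close>.\<close>

lemma kl_div_density_le:
  fixes g :: "'a \<Rightarrow> real"
  assumes \<nu>: "sigma_finite_measure \<nu>" and \<rho>: "prob_space \<rho>"
    and g [measurable]: "g \<in> borel_measurable \<nu>"
    and dens: "\<rho> = density \<nu> (\<lambda>x. ennreal (g x))"
    and bounds: "AE x in \<rho>. 0 < g x \<and> A \<le> ln (g x) \<and> ln (g x) \<le> B"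
  shows "kl_div \<rho> \<nu> \<le> ereal B"
proof -
  interpret \<nu>: sigma_finite_measure \<nu> by fact
  interpret \<rho>: prob_space \<rho> by fact
  have ac: "absolutely_continuous \<nu> \<rho>"
    unfolding dens by (rule absolutely_continuousI_density) simp
  have "AE x in \<nu>. ennreal (g x) = RN_deriv \<nu> \<rho> x"
    by (rule \<nu>.RN_deriv_unique) (simp_all add: dens)
  then have "AE x in \<rho>. ennreal (g x) = RN_deriv \<nu> \<rho> x"
    using ac by (simp add: absolutely_continuous_AE dens)
  \<comment> \<open>Where \<open>g\<close> is positive, its passage through \<open>ennreal\<close>
    loses nothing, and base \<open>exp 1\<close> turns \<open>log\<close> into
    \<open>ln\<close>.\<close>
  with bounds have AE: "AE x in \<rho>. A \<le> entropy_density (exp 1) \<nu> \<rho> x \<and> entropy_density (exp 1) \<nu> \<rho> x \<le> B"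
    by eventually_elim (auto simp: entropy_density_def log_def dest: sym)
  have "entropy_density (exp 1) \<nu> \<rho> \<in> borel_measurable \<rho>"
    unfolding entropy_density_def by (simp add: dens)
  with AE have int: "integrable \<rho> (entropy_density (exp 1) \<nu> \<rho>)"
    by (intro \<rho>.integrable_const_bound[where B = "max \<bar>A\<bar> \<bar>B\<bar>"]) auto
  with AE have "(\<integral>x. entropy_density (exp 1) \<nu> \<rho> x \<partial>\<rho>) \<le> B"
    by (intro \<rho>.integral_le_const) auto
  with ac int show ?thesis by (simp add: kl_div_def KL_divergence_def)
qed

section \<open>Power laws on subintervals and the trial measures built from them\<close>

lemma unit_cube_eq_cbox: "unit_cube = cbox (0::real^'d) 1"
  by (auto simp: unit_cube_def mem_box_cart)

text \<open>For \<open>e > 0\<close> this is the law of \<open>e * V\<close> with \<open>V\<close>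
  distributed as Beta(a + 1, 1).\<close>

definition power_density :: "nat \<Rightarrow> real \<Rightarrow> real \<Rightarrow> ennreal" where
  "power_density a e x = ennreal (real (Suc a) / e ^ Suc a * x ^ a) * indicator {0..e} x"

lemma borel_measurable_power_density [measurable]: "power_density a e \<in> borel_measurable borel"
  unfolding power_density_def by measurable

lemma prob_space_power_density: "e > 0 \<Longrightarrow> prob_space (density lborel (power_density a e))"
  by (intro prob_spaceI)
     (simp add: emeasure_density power_density_def nn_integral_power_density
       del: power_Suc of_nat_Suc times_divide_eq_left)

lemma prob_measure_on_power_density:
  assumes "0 < e" "e \<le> 1"
  shows "prob_measure_on {0..1} (density lborel (power_density a e))"
proof -
  interpret prob_space "density lborel (power_density a e)"
    using assms by (intro prob_space_power_density)
  have "emeasure (density lborel (power_density a e)) {0..1} = 1"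
    using assms by (intro emeasure_eq_1_AE) (auto simp: AE_density power_density_def indicator_def)
  then show ?thesis by (simp add: prob_measure_on_def prob_space_axioms)
qed

text \<open>Only continuity of \<open>b\<close> and its bounds matter from here on: \<open>m\<close>
  controls the divergence from above, while \<open>M\<close> bounds the log-density from below and
  so secures integrability.\<close>

locale normal_crossing_prior =
  fixes h :: "nat^'d" and b \<phi> :: "real^'d \<Rightarrow> real" and c m M :: real
  assumes b_cont: "continuous_on unit_cube b"
    and b_bounds: "\<And>x. x \<in> unit_cube \<Longrightarrow> m \<le> b x \<and> b x \<le> M"
    and m_pos: "0 < m" and c_pos: "0 < c"
    and phi: "\<And>x. x \<in> unit_cube \<Longrightarrow> \<phi> x = c * (b x * mpow x h)"
    and prob_phi: "prob_space (cube_measure \<phi>)"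
begin

text \<open>The exponents are those of the prior, so that the monomials cancel in the relative
  density; each coordinate has its own scale.\<close>

definition trial :: "('d \<Rightarrow> real) \<Rightarrow> (real^'d) measure" where
  "trial e = product_measure (\<lambda>j. density lborel (power_density (h $ j) (e j)))"

definition normalizer :: "('d \<Rightarrow> real) \<Rightarrow> real" where
  "normalizer e = (\<Prod>j\<in>UNIV. real (Suc (h $ j)) / e j ^ Suc (h $ j))"

text \<open>The density relative to the prior after cancelling \<open>mpow x h\<close>. Nothing is
  divided by the monomial, so the formula stays bounded on faces where the prior density
  vanishes.\<close>

definition trial_density :: "('d \<Rightarrow> real) \<Rightarrow> real^'d \<Rightarrow> real" where
  "trial_density e x = indicator (cbox 0 (\<chi> j. e j)) x *\<^sub>R (normalizer e / (c * b x))"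

context
  fixes e :: "'d \<Rightarrow> real"
  assumes e_pos: "\<And>j. 0 < e j" and e_le_1: "\<And>j. e j \<le> 1"
begin

lemma box_subset_unit_cube: "cbox 0 (\<chi> j. e j) \<subseteq> unit_cube"
  using e_le_1 by (auto simp: unit_cube_def mem_box_cart) (meson order_trans)

lemma normalizer_pos: "0 < normalizer e"
  unfolding normalizer_def by (intro prod_pos divide_pos_pos ballI) (auto simp: e_pos)

lemma b_pos_on_cube: "x \<in> unit_cube \<Longrightarrow> 0 < b x"
  using b_bounds[of x] m_pos by linarith

lemma borel_measurable_trial_density: "trial_density e \<in> borel_measurable borel"
  unfolding trial_density_def
  using box_subset_unit_cube b_pos_on_cube c_pos
  by (intro borel_measurable_continuous_on_indicator continuous_intros
        continuous_on_subset[OF b_cont]) (auto simp: less_le)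

text \<open>Inside the box, both Lebesgue densities equal \<open>normalizer e * mpow x h\<close>;
  outside it, some coordinate leaves its interval and both vanish. The identity is pointwise,
  including where the monomial is zero.\<close>

lemma trial_eq_density_cube_measure:
  "trial e = density (cube_measure \<phi>) (\<lambda>x. ennreal (trial_density e x))"
proof -
  \<comment> \<open>The values of \<open>\<phi>\<close> off the cube are arbitrary, but cut off by
    the indicator it agrees with a continuous function restricted to a closed set.\<close>
  have phi_measurable: "(\<lambda>x. ennreal (\<phi> x) * indicator unit_cube x) \<in> borel_measurable borel"
  proof -
    have "continuous_on unit_cube (\<lambda>x. c * (b x * mpow x h))"
      using continuous_on_mpow[of unit_cube 0 h] by (auto intro!: continuous_intros b_cont)
    then have "(\<lambda>x. indicator unit_cube x *\<^sub>R (c * (b x * mpow x h))) \<in> borel_measurable borel"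
      by (intro borel_measurable_continuous_on_indicator) (auto simp: unit_cube_eq_cbox)
    then have "(\<lambda>x. ennreal (indicator unit_cube x *\<^sub>R (c * (b x * mpow x h)))) \<in> borel_measurable borel"
      by measurable
    moreover have "ennreal (indicator unit_cube x *\<^sub>R (c * (b x * mpow x h))) =
        ennreal (\<phi> x) * indicator unit_cube x" for x
      by (simp add: indicator_def phi)
    ultimately show ?thesis by simp
  qed
  have pointwise: "(\<Prod>j\<in>UNIV. power_density (h $ j) (e j) (x $ j)) =
      ennreal (\<phi> x) * indicator unit_cube x * ennreal (trial_density e x)" for x
  proof (cases "x \<in> cbox 0 (\<chi> j. e j)")
    case True
    with box_subset_unit_cube have cube: "x \<in> unit_cube" by blast
    have "(\<Prod>j\<in>UNIV. power_density (h $ j) (e j) (x $ j)) =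
        (\<Prod>j\<in>UNIV. ennreal (real (Suc (h $ j)) / e j ^ Suc (h $ j) * (x $ j) ^ (h $ j)))"
      using True by (intro prod.cong) (auto simp: power_density_def mem_box_cart)
    also have "\<dots> = ennreal (normalizer e * mpow x h)"
      using True e_pos unfolding normalizer_def mpow_def prod.distrib[symmetric]
      by (subst prod_ennreal) (auto simp: mem_box_cart less_imp_le)
    also have "normalizer e * mpow x h = \<phi> x * trial_density e x"
      using True b_pos_on_cube[OF cube] c_pos by (simp add: phi[OF cube] trial_density_def)
    also have "ennreal \<dots> = ennreal (\<phi> x) * ennreal (trial_density e x)"
      using b_pos_on_cube[OF cube] c_pos normalizer_pos
      by (intro ennreal_mult'') (simp add: trial_density_def)
    finally show ?thesis using cube by simp
  next
    case False
    then obtain j where "x $ j \<notin> {0..e j}" by (auto simp: mem_box_cart)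
    then have "power_density (h $ j) (e j) (x $ j) = 0" by (simp add: power_density_def)
    then have "(\<Prod>j\<in>UNIV. power_density (h $ j) (e j) (x $ j)) = 0"
      by (intro prod_zero) auto
    with False show ?thesis by (simp add: trial_density_def)
  qed
  have "trial e = density lborel (\<lambda>x. \<Prod>j\<in>UNIV. power_density (h $ j) (e j) (x $ j))"
    unfolding trial_def
    using prob_space_power_density e_pos
    by (intro product_measure_density)
       (auto intro: prob_space_imp_sigma_finite)
  also have "\<dots> = density (cube_measure \<phi>) (\<lambda>x. ennreal (trial_density e x))"
    unfolding cube_measure_def pointwise using phi_measurable borel_measurable_trial_density
    by (subst density_density_eq) auto
  finally show ?thesis .
qed

lemma borel_measurable_trial_density_cube_measure:
  "trial_density e \<in> borel_measurable (cube_measure \<phi>)"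
  using borel_measurable_trial_density by (simp add: cube_measure_def)

lemma prob_space_trial: "prob_space (trial e)"
  unfolding trial_def product_measure_def
  using measurable_vec_lambda
  by (intro prob_space.prob_space_distr prob_space_PiM prob_space_power_density e_pos)
     (simp cong: measurable_cong_sets sets_PiM_cong)

lemma AE_trial: "AE x in trial e. x \<in> cbox 0 (\<chi> j. e j)"
  unfolding trial_eq_density_cube_measure
  using measurable_compose[OF borel_measurable_trial_density_cube_measure measurable_ennreal]
  by (subst AE_density) (auto intro!: AE_I2 simp: trial_density_def indicator_def split: if_splits)

lemma trial_mean_field: "trial e \<in> mean_field \<phi>"
proof -
  have "emeasure (trial e) unit_cube = 1"
    using AE_trial box_subset_unit_cube
    by (intro prob_space.emeasure_eq_1_AE[OF prob_space_trial])
       (auto simp: trial_def unit_cube_eq_cbox)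
  then have "prob_measure_on unit_cube (trial e)"
    using prob_space_trial by (simp add: prob_measure_on_def trial_def)
  moreover have "absolutely_continuous (cube_measure \<phi>) (trial e)"
    unfolding trial_eq_density_cube_measure
    using borel_measurable_trial_density_cube_measure
    by (intro absolutely_continuousI_density) auto
  ultimately show ?thesis
    using prob_measure_on_power_density[OF e_pos e_le_1]
    unfolding mean_field_def trial_def mem_Collect_eq
    by (intro conjI exI[of _ "\<lambda>j. density lborel (power_density (h $ j) (e j))"]) auto
qed

text \<open>On the box the relative density is \<open>normalizer e / (c * b x)\<close>, so the
  bounds on \<open>b\<close> trap its logarithm between two constants.\<close>

lemma kl_div_trial_le: "kl_div (trial e) (cube_measure \<phi>) \<le> ereal (ln (normalizer e) - ln (c * m))"
proof (rule kl_div_density_le[OF _ prob_space_trial _ trial_eq_density_cube_measure])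
  show "sigma_finite_measure (cube_measure \<phi>)"
    using prob_phi by (rule prob_space_imp_sigma_finite)
  show "trial_density e \<in> borel_measurable (cube_measure \<phi>)"
    by (rule borel_measurable_trial_density_cube_measure)
  show "AE x in trial e. 0 < trial_density e x \<and>
      ln (normalizer e) - ln (c * M) \<le> ln (trial_density e x) \<and>
      ln (trial_density e x) \<le> ln (normalizer e) - ln (c * m)"
    using AE_trial
  proof eventually_elim
    fix x assume x: "x \<in> cbox 0 (\<chi> j. e j)"
    with box_subset_unit_cube have cube: "x \<in> unit_cube" by blast
    have "trial_density e x = normalizer e / (c * b x)" using x by (simp add: trial_density_def)
    moreover have "c * m \<le> c * b x" "c * b x \<le> c * M" "0 < c * m" "0 < c * b x"
      using b_bounds[OF cube] b_pos_on_cube[OF cube] c_pos m_pos by auto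
    ultimately show "0 < trial_density e x \<and>
        ln (normalizer e) - ln (c * M) \<le> ln (trial_density e x) \<and>
        ln (trial_density e x) \<le> ln (normalizer e) - ln (c * m)"
      using normalizer_pos by (auto simp: ln_div)
  qed
qed

text \<open>One suitably small coordinate suffices, since the remaining factors of
  \<open>normal_crossing k\<close> are at most 1 on the cube. Hence the energy term is at most 1,
  which is the 1 in the bound.\<close>

lemma Psi_trial_ge:
  assumes e: "real n * e j ^ (2 * k $ j) \<le> 1"
  shows "Psi (normal_crossing k) \<phi> n (trial e) \<ge> - ereal (1 + ln (normalizer e) - ln (c * m))"
proof -
  interpret prob_space "trial e" by (rule prob_space_trial)
  have AE: "AE x in trial e. 0 \<le> real n * normal_crossing k x \<and> real n * normal_crossing k x \<le> 1"
    using AE_trial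
  proof eventually_elim
    fix x assume x: "x \<in> cbox 0 (\<chi> j. e j)"
    then have x': "0 \<le> x $ i" "x $ i \<le> e i" "x $ i \<le> 1" for i
      using e_le_1[of i] by (auto simp: mem_box_cart intro: order_trans)
    have "normal_crossing k x = (x $ j) ^ (2 * k $ j) * (\<Prod>i\<in>UNIV - {j}. (x $ i) ^ (2 * k $ i))"
      unfolding normal_crossing_def by (rule prod.remove) auto
    also have "\<dots> \<le> e j ^ (2 * k $ j) * 1"
      using x' e_pos[of j]
      by (intro mult_mono power_mono prod_le_1 prod_nonneg) (auto intro: power_le_one)
    finally have "real n * normal_crossing k x \<le> real n * e j ^ (2 * k $ j)"
      by (intro mult_left_mono) auto
    moreover have "0 \<le> normal_crossing k x"
      unfolding normal_crossing_def using x' by (intro prod_nonneg) auto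
    ultimately show "0 \<le> real n * normal_crossing k x \<and> real n * normal_crossing k x \<le> 1"
      using e by simp
  qed
  \<comment> \<open>This is the integrand of the set integral in \<open>Psi\<close>; its almost sure
    bound by 1 gives both integrability and the bound on the integral.\<close>
  define f where "f x = indicator unit_cube x *\<^sub>R (real n * normal_crossing k x)" for x :: "real^'d"
  have "continuous_on unit_cube (\<lambda>x. real n * normal_crossing k x)"
    unfolding normal_crossing_def by (intro continuous_intros)
  then have "(\<lambda>x. indicator unit_cube x *\<^sub>R (real n * normal_crossing k x)) \<in> borel_measurable borel"
    by (intro borel_measurable_continuous_on_indicator) (simp_all add: unit_cube_eq_cbox)
  then have "f \<in> borel_measurable (trial e)"
    unfolding f_def trial_def
    by (simp cong: measurable_cong_sets)
  moreover have f_le: "AE x in trial e. \<bar>f x\<bar> \<le> 1"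
    using AE by eventually_elim (auto simp: f_def indicator_def)
  ultimately have "integrable (trial e) f"
    by (intro integrable_const_bound[where B = 1]) auto
  then have "(\<integral>x. f x \<partial>trial e) \<le> 1"
    using f_le by (intro integral_le_const) auto
  then have "(LINT x:unit_cube|trial e. real n * normal_crossing k x) \<le> 1"
    unfolding set_lebesgue_integral_def f_def .
  then have "ereal (LINT x:unit_cube|trial e. real n * normal_crossing k x) + kl_div (trial e) (cube_measure \<phi>)
      \<le> ereal 1 + ereal (ln (normalizer e) - ln (c * m))"
    by (intro add_mono kl_div_trial_le) auto
  then show ?thesis
    unfolding Psi_def ereal_minus_le_minus by (simp add: add_diff_eq)
qed

end

text \<open>Coordinates with scale 1 contribute only their constants, so the sole dependence on
  \<epsilon> comes from coordinate \<open>j\<close>, with the factor \<open>h $ j + 1\<close> that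
  becomes the numerator of the rate.\<close>

lemma ln_normalizer_update:
  assumes "0 < \<epsilon>"
  shows "ln (normalizer ((\<lambda>_. 1)(j := \<epsilon>))) = ln (\<Prod>i\<in>UNIV. real (Suc (h $ i))) - real (Suc (h $ j)) * ln \<epsilon>"
proof -
  have "normalizer ((\<lambda>_. 1)(j := \<epsilon>)) = (\<Prod>i\<in>UNIV. real (Suc (h $ i))) / (\<Prod>i\<in>UNIV. ((\<lambda>_. 1)(j := \<epsilon>)) i ^ Suc (h $ i))"
    by (simp add: normalizer_def prod_dividef)
  also have "(\<Prod>i\<in>UNIV. ((\<lambda>_. 1)(j := \<epsilon>)) i ^ Suc (h $ i)) = (\<Prod>i\<in>UNIV. if i = j then \<epsilon> ^ Suc (h $ j) else 1)"
    by (intro prod.cong) auto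
  also have "\<dots> = \<epsilon> ^ Suc (h $ j)" by (subst prod.delta) auto
  finally show ?thesis
    using assms by (simp add: ln_div prod_pos ln_realpow del: power_Suc of_nat_Suc fun_upd_apply)
qed

end

section \<open>Choice of coordinate, scale and constant\<close>

theorem theorem3p1:
  fixes k h :: "nat^'d"
    and b \<phi> :: "real^'d \<Rightarrow> real"
    and U :: "(real^'d) set"
    and c :: real
  assumes k_pos: "\<exists>j. k $ j > 0"
    and b_analytic: "open U" "unit_cube \<subseteq> U" "real_analytic_on b U"
    and b_pos: "\<And>x. x \<in> unit_cube \<Longrightarrow> b x > 0"
    and phi_prop: "c > 0" "\<And>x. x \<in> unit_cube \<Longrightarrow> \<phi> x = c * (b x * mpow x h)"
    and phi_density: "prob_space (cube_measure \<phi>)"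
  shows "\<exists>C::real. \<forall>n::nat. n \<ge> 1 \<longrightarrow>
           ELBO (normal_crossing k) \<phi> n (mean_field \<phi>)
             \<ge> - (rlct k h * ereal (ln (real n))) - ereal C"
proof -
  have cube: "compact (unit_cube :: (real^'d) set)" "(0 :: real^'d) \<in> unit_cube"
    by (simp_all add: unit_cube_eq_cbox mem_box_cart)
  have cont: "continuous_on unit_cube b"
    \<comment> \<open>Analyticity is used for continuity alone; compactness of the cube then yields
      a positive minimum \<open>b y\<close> and a maximum \<open>b z\<close>.\<close>
    using real_analytic_on_imp_continuous_on b_analytic continuous_on_subset by blast
  obtain y where y: "y \<in> unit_cube" "\<And>x. x \<in> unit_cube \<Longrightarrow> b y \<le> b x"
    using continuous_attains_inf[OF cube(1) _ cont] cube(2) by blast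
  obtain z where z: "\<And>x. x \<in> unit_cube \<Longrightarrow> b x \<le> b z"
    using continuous_attains_sup[OF cube(1) _ cont] cube(2) by blast
  interpret normal_crossing_prior h b \<phi> c "b y" "b z"
  proof (rule normal_crossing_prior.intro)
    show "b y \<le> b x \<and> b x \<le> b z" if "x \<in> unit_cube" for x
      using y(2) z that by blast
  qed (fact cont b_pos[OF y(1)] phi_prop phi_density)+
  define r where "r j = (if k $ j = 0 then \<infinity> else ereal ((real (h $ j) + 1) / (2 * real (k $ j))))" for j
  have "rlct k h \<in> range r"
    unfolding rlct_def r_def by (intro Min_in) auto
  then obtain j where j: "rlct k h = r j" by blast
  obtain i where i: "k $ i > 0" using k_pos by blast
  have "rlct k h \<le> r i"
    unfolding rlct_def r_def by (intro Min_le) auto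
  \<comment> \<open>Since \<open>r i\<close> is finite, so is the minimum, and the minimizing
    coordinate cannot have exponent zero.\<close>
  with i j have kj: "k $ j > 0" by (auto simp: r_def split: if_splits)
  \<comment> \<open>The 1 bounds the energy, the logarithm of the product comes from the normalizing
    constants of the power laws, and \<open>c * b y\<close> bounds \<open>c * b x\<close> from
    below.\<close>
  define C where "C = 1 + ln (\<Prod>i\<in>UNIV. real (Suc (h $ i))) - ln (c * b y)"
  have "ELBO (normal_crossing k) \<phi> n (mean_field \<phi>) \<ge> - (rlct k h * ereal (ln (real n))) - ereal C"
    if n: "n \<ge> 1" for n
  proof -
    define \<epsilon> where "\<epsilon> = real n powr (- 1 / (2 * real (k $ j)))"
    define e where "e = (\<lambda>_. 1)(j := \<epsilon>)"
    have \<epsilon>: "0 < \<epsilon>" "\<epsilon> \<le> 1"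
      using n kj powr_mono[of "- 1 / (2 * real (k $ j))" 0 "real n"] by (auto simp: \<epsilon>_def)
    have "\<epsilon> ^ (2 * k $ j) = real n powr (- 1)"
      using n kj by (simp add: \<epsilon>_def powr_powr flip: powr_realpow)
    \<comment> \<open>The scale is chosen to make this an equality:
      \<open>n * (1 / n) = 1\<close>.\<close>
    then have "real n * e j ^ (2 * k $ j) \<le> 1"
      using n by (simp add: e_def powr_minus)
    then have "- ereal (1 + ln (normalizer e) - ln (c * b y)) \<le> Psi (normal_crossing k) \<phi> n (trial e)"
      using \<epsilon> by (intro Psi_trial_ge) (auto simp: e_def)
    also have "\<dots> \<le> ELBO (normal_crossing k) \<phi> n (mean_field \<phi>)"
      unfolding ELBO_def using \<epsilon> by (intro SUP_upper trial_mean_field) (auto simp: e_def)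
    \<comment> \<open>Here \<open>- ln \<epsilon> = ln n / (2 * k $ j)\<close>, so the factor
      \<open>h $ j + 1\<close> turns into the coefficient \<open>rlct k h\<close> of
      \<open>ln n\<close>.\<close>
    also have "1 + ln (normalizer e) - ln (c * b y) = (real (h $ j) + 1) / (2 * real (k $ j)) * ln (real n) + C"
      using n \<epsilon> by (simp add: e_def ln_normalizer_update C_def) (simp add: \<epsilon>_def ln_powr field_simps)
    finally show ?thesis using kj by (simp add: j r_def)
  qed
  then show ?thesis by blast
qed

end
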